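(* If $G$ is a connected $P_3$-$o_{-1}$-heavy graph, then $G$ is traceable (i.e., $G$ contains a path passing through all its vertices).
   Context: All graphs are finite and simple; $d(v)$ is the degree of $v$ in $G$. $P_3$ is the path on 3 vertices. For a graph $H$, a graph $G$ on $n$ vertices is called $H$-$o_{-1}$-heavy if every induced subgraph of $G$ isomorphic to $H$ contains two nonadjacent vertices whose degree sum in $G$ is at least $n-1$. *)

theory Defs
  imports "Graph_Theory.Graph_Theory"
begin

text \<open>
  Finite simple graphs are the locale \<^locale>\<open>graph\<close>: finite digraphs without loops and
  parallel arcs whose arc relation is symmetric. Every edge \<open>uv\<close> is thus the pair of arcs
  \<open>(u,v)\<close> and \<open>(v,u)\<close>, so the degree of \<open>v\<close> is its out-degree, which equals its in-degree.
\<close>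

definition path_graph :: "nat \<Rightarrow> nat pair_pre_digraph" where
  "path_graph k = \<lparr> pverts = {..<k},
     parcs = {(i, j). i < k \<and> j < k \<and> (j = Suc i \<or> i = Suc j)} \<rparr>"

text \<open>
  For symmetric digraphs without parallel arcs, \<^const>\<open>digraph_iso\<close> is the usual isomorphism of
  simple graphs. The truncated subtraction is harmless: for an empty \<open>G\<close> both readings of the
  inequality hold.
\<close>

definition o_minus_one_heavy :: "('c, 'd) pre_digraph \<Rightarrow> ('a, 'b) pre_digraph \<Rightarrow> bool" where
  "o_minus_one_heavy H G \<longleftrightarrow>
     (\<forall>K. induced_subgraph K G \<and> digraph_iso K H \<longrightarrow>
        (\<exists>u \<in> verts K. \<exists>v \<in> verts K. u \<noteq> v \<and> (u, v) \<notin> arcs_ends G \<and>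
           out_degree G u + out_degree G v \<ge> card (verts G) - 1))"

definition traceable :: "('a, 'b) pre_digraph \<Rightarrow> bool" where
  "traceable G \<longleftrightarrow> (\<exists>p. vpath p G \<and> set p = verts G)"

lemma graph_path_graph: "graph (with_proj (path_graph k))"
proof -
  have "parcs (path_graph k) \<subseteq> {..<k} \<times> {..<k}"
    by (auto simp: path_graph_def)
  then have fin: "finite (parcs (path_graph k))"
    by (rule finite_subset) simp
  show ?thesis
    using fin by unfold_locales
      (auto simp: path_graph_def arc_to_ends_def symmetric_def arcs_ends_def sym_def image_iff)
qed

end

theory Submission
  imports Defs
begin

text \<open>
  Take a longest path \<open>P = v\<^sub>1 \<dots> v\<^sub>k\<close> and suppose that it misses a vertex. By connectedness
  some \<open>x\<close> off \<open>P\<close> is adjacent to some \<open>v\<^sub>i\<close>; put \<open>y = v\<^sub>i\<^sub>+\<^sub>1\<close>. By maximality \<open>x\<close> and \<open>y\<close> are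
  nonadjacent, so \<open>x v\<^sub>i y\<close> is an induced \<open>P\<^sub>3\<close> and \<open>d(x) + d(y) \<ge> n - 1\<close>. Replace every neighbour
  of \<open>x\<close> on \<open>P\<close> by its successor and keep the other neighbours. Maximality of \<open>P\<close> makes the resulting
  set of \<open>d(x)\<close> vertices disjoint from the neighbourhood of \<open>y\<close>, and neither set contains \<open>x\<close> or
  \<open>v\<^sub>1\<close>; hence \<open>d(x) + d(y) \<le> n - 2\<close>, a contradiction.
\<close>

text \<open>A walk is stored as a vertex list, so the arc condition amounts to adjacency of
  consecutive entries. In this form cutting, reversing and joining paths become facts about
  \<open>successively\<close>.\<close>

lemma vpath_iff:
  "vpath p G \<longleftrightarrow> p \<noteq> [] \<and> set p \<subseteq> verts G \<and> distinct p \<and> successively (dominates G) p"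
proof -
  have "set (vwalk_arcs p) \<subseteq> arcs_ends G \<longleftrightarrow> successively (dominates G) p"
    by (induction p rule: vwalk_arcs.induct) auto
  then show ?thesis
    unfolding vpath_def vwalk_def by auto
qed

section \<open>Neighbourhoods, longest paths and connectedness\<close>

context graph
begin

definition neighbours :: "'a \<Rightarrow> 'a set" where
  "neighbours v = {u. v \<rightarrow> u}"

lemma adj_sym: "u \<rightarrow> v \<longleftrightarrow> v \<rightarrow> u"
  using arcs_ends_symmetric[OF sym_arcs] by blast

lemma neighbours_subset: "neighbours v \<subseteq> verts G"
  unfolding neighbours_def using adj_in_verts by blast

lemma out_degree_eq_card_neighbours: "out_degree G v = card (neighbours v)"
proof -
  have "neighbours v = head G ` out_arcs G v"
    unfolding neighbours_def arcs_ends_conv by (auto simp: image_iff)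
  moreover have "inj_on (head G) (out_arcs G v)"
    using no_multi_arcs by (intro inj_onI) (auto simp: arc_to_ends_def)
  ultimately show ?thesis
    unfolding out_degree_def by (simp add: card_image)
qed

lemma exists_longest_vpath:
  assumes "verts G \<noteq> {}"
  obtains p where "vpath p G" and "\<And>q. vpath q G \<Longrightarrow> length q \<le> length p"
proof -
  obtain v where "v \<in> verts G"
    using assms by blast
  then have "vpath [v] G"
    by (simp add: vpath_iff)
  moreover have "length q < Suc (card (verts G))" if "vpath q G" for q
    using that card_mono[OF finite_verts, of "set q"]
    by (auto simp: vpath_iff distinct_card less_Suc_eq_le)
  ultimately show thesis
    using ex_has_greatest_nat[of "\<lambda>p. vpath p G" _ length] that by blast
qed

text \<open>Any walk from \<open>A\<close> to its complement must leave \<open>A\<close> along some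
  edge. With \<open>A\<close> the vertex set of a longest path, this provides a vertex off the path
  with a neighbour on it.\<close>

lemma connected_exits_subset:
  assumes "connected G" "A \<subseteq> verts G" "A \<noteq> {}" "A \<noteq> verts G"
  obtains u v where "u \<in> A" "v \<in> verts G" "v \<notin> A" "u \<rightarrow> v"
proof -
  obtain a b where ab: "a \<in> A" "b \<in> verts G" "b \<notin> A"
    using assms by blast
  have "a \<rightarrow>\<^sup>*\<^bsub>mk_symmetric G\<^esub> b"
    using assms ab unfolding connected_def strongly_connected_def by auto
  then have "a \<rightarrow>\<^sup>* b"
    using reachable_mk_symmetric_eq[OF sym_arcs] by blast
  then have "b \<in> A \<or> (\<exists>u\<in>A. \<exists>v. v \<notin> A \<and> u \<rightarrow> v)"
    by (induction rule: reachable_induct) (use ab in auto)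
  then show thesis
    using ab that adj_in_verts by blast
qed

text \<open>Since \<open>x\<close> and \<open>y\<close> are nonadjacent, \<open>{x, w, y}\<close>
  induces a path with middle vertex \<open>w\<close>, to which heaviness applies.\<close>

lemma o_minus_one_heavy_path_graph_3D:
  assumes heavy: "o_minus_one_heavy (with_proj (path_graph 3)) G"
    and adj: "x \<rightarrow> w" "w \<rightarrow> y"
    and nadj: "\<not> x \<rightarrow> y" "x \<noteq> y"
  shows "card (verts G) - 1 \<le> out_degree G x + out_degree G y"
proof -
  define K where "K = G \<restriction> {x, w, y}"
  \<comment> \<open>The default value 2 is meant for \<open>y\<close>, the only other vertex of
    \<open>K\<close>.\<close>
  define f where "f v = (if v = x then 0 else if v = w then 1 else (2::nat))" for v
  \<comment> \<open>Each arc goes to the pair of images of its ends, and \<open>fst\<close>,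
    \<open>snd\<close> are the projections of \<open>with_proj\<close>; so the image of
    \<open>K\<close> is literally the path graph.\<close>
  define h where "h = \<lparr>iso_verts = f, iso_arcs = (\<lambda>e. (f (tail G e), f (head G e))),
    iso_head = snd, iso_tail = fst\<rparr>"
  have neq: "x \<noteq> w" "w \<noteq> y"
    using adj adj_not_same by auto
  have V: "{x, w, y} \<subseteq> verts G"
    using adj adj_in_verts by blast
  have ind: "induced_subgraph K G"
    unfolding K_def using V by (rule induced_induce)
  then have wf: "wf_digraph K"
    by (simp add: induced_subgraph_def subgraph_def)
  have K_simps: "verts K = {x, w, y}" "tail K = tail G" "head K = head G"
    "arcs K = {e \<in> arcs G. tail G e \<in> {x, w, y} \<and> head G e \<in> {x, w, y}}"
    by (auto simp: K_def)
  have f_simps: "f x = 0" "f w = 1" "f y = 2"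
    using nadj neq by (auto simp: f_def)
  have inj: "inj_on f {x, w, y}"
    using f_simps by (auto simp: inj_on_def)
  have "inj_on (iso_arcs h) (arcs K)"
  proof (rule inj_onI)
    fix e e'
    assume e: "e \<in> arcs K" "e' \<in> arcs K" and "iso_arcs h e = iso_arcs h e'"
    then have "f (tail G e) = f (tail G e')" "f (head G e) = f (head G e')"
      by (auto simp: h_def)
    then have "tail G e = tail G e'" "head G e = head G e'"
      using e inj_onD[OF inj] by (simp_all add: K_simps)
    then show "e = e'"
      using e no_multi_arcs by (simp add: K_simps arc_to_ends_def)
  qed
  then have iso: "pre_digraph.digraph_isomorphism K h"
    using inj wf by (simp add: pre_digraph.digraph_isomorphism_def K_simps h_def)
  have ends: "(\<lambda>e. (tail G e, head G e)) ` arcs K = {(x, w), (w, x), (w, y), (y, w)}"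
    (is "?L = ?R")
  proof
    show "?L \<subseteq> ?R"
    proof
      fix p
      assume "p \<in> ?L"
      then obtain a b where p: "p = (a, b)" "a \<in> {x, w, y}" "b \<in> {x, w, y}" "a \<rightarrow> b"
        by (auto simp: K_simps arcs_ends_conv)
      then show "p \<in> ?R"
        using nadj adj_sym adj_not_same by auto
    qed
    have "(a, b) \<in> ?L" if "a \<rightarrow> b" "a \<in> {x, w, y}" "b \<in> {x, w, y}" for a b
      using that unfolding arcs_ends_conv K_simps by (elim imageE) (auto intro!: image_eqI)
    then show "?R \<subseteq> ?L"
      using adj adj_sym by auto
  qed
  have "iso_arcs h ` arcs K = map_prod f f ` (\<lambda>e. (tail G e, head G e)) ` arcs K"
    by (auto simp: h_def image_image)
  also have "\<dots> = {(0, 1), (1, 0), (1, 2), (2, 1)}"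
    unfolding ends by (simp add: f_simps)
  also have "\<dots> = parcs (path_graph 3)"
    by (auto simp: path_graph_def)
  finally have arcs: "iso_arcs h ` arcs K = parcs (path_graph 3)" .
  have verts: "iso_verts h ` verts K = pverts (path_graph 3)"
    by (auto simp: h_def K_simps f_simps path_graph_def)
  have "with_proj (path_graph 3) = app_iso h K"
    using arcs verts by (simp add: app_iso_def with_proj_def) (simp add: h_def)
  with iso have "digraph_iso K (with_proj (path_graph 3))"
    by (auto simp: digraph_iso_def)
  with heavy ind obtain u v where "u \<in> {x, w, y}" "v \<in> {x, w, y}" "u \<noteq> v" "\<not> u \<rightarrow> v"
    "card (verts G) - 1 \<le> out_degree G u + out_degree G v"
    unfolding o_minus_one_heavy_def K_simps(1)[symmetric] by blast
  \<comment> \<open>The only nonadjacent pair in \<open>K\<close> is \<open>x\<close>,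
    \<open>y\<close>, so the heavy pair is this one, in either order.\<close>
  then show ?thesis
    using adj adj_sym by (auto simp: add.commute)
qed

section \<open>Rearrangements of a longest path together with a vertex off it\<close>

context
  fixes p :: "'a list" and x :: 'a
  assumes path: "vpath p G"
    and longest: "\<And>q. vpath q G \<Longrightarrow> length q \<le> length p"
    and x: "x \<in> verts G" "x \<notin> set p"
begin

lemma path_props:
  "p \<noteq> []" "set p \<subseteq> verts G" "distinct p" "successively (dominates G) p"
  using path by (auto simp: vpath_iff)

text \<open>Such a \<open>q\<close> would be a path longer than \<open>p\<close>. To refute a
  configuration it therefore suffices to exhibit an ordering of \<open>x\<close> and the vertices of
  \<open>p\<close> with consecutive entries adjacent.\<close>

lemma not_successively_permuted_insert:
  assumes "mset q = add_mset x (mset p)"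
  shows "\<not> successively (dominates G) q"
proof
  assume "successively (dominates G) q"
  moreover have "distinct q \<longleftrightarrow> distinct (x # p)" "set q = insert x (set p)" "length q = Suc (length p)"
    using assms mset_eq_imp_distinct_iff[of q "x # p"] mset_eq_setD[of q "x # p"]
      mset_eq_length[of q "x # p"] by auto
  ultimately have "vpath q G"
    using x path_props by (auto simp: vpath_iff)
  then show False
    using longest[of q] \<open>length q = _\<close> by simp
qed

text \<open>By symmetry of adjacency a segment may be traversed backwards. This replaces
  \<open>successively_rev\<close>, which would flip the relation.\<close>

lemma successively_rev_adj: "successively (dominates G) (rev q) \<longleftrightarrow> successively (dominates G) q"
  unfolding successively_rev using adj_sym by (intro successively_cong) auto

lemma split_path:
  assumes "Suc i < length p"
  obtains as bs where "p = as @ bs" "as \<noteq> []" "bs \<noteq> []" "last as = p ! i" "hd bs = p ! Suc i"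
    "successively (dominates G) as" "successively (dominates G) bs"
proof
  show p: "p = take (Suc i) p @ drop (Suc i) p"
    by simp
  show "last (take (Suc i) p) = p ! i" "hd (drop (Suc i) p) = p ! Suc i"
    using assms by (auto simp: take_Suc_conv_app_nth hd_drop_conv_nth)
  show "successively (dominates G) (take (Suc i) p)" "successively (dominates G) (drop (Suc i) p)"
    using path_props(4) p by (metis successively_append_iff)+
qed (use assms in auto)

lemma not_adj_hd: "\<not> x \<rightarrow> hd p"
  using not_successively_permuted_insert[of "x # p"] path_props by (auto simp: successively_Cons)

lemma not_adj_last: "\<not> x \<rightarrow> last p"
  using not_successively_permuted_insert[of "p @ [x]"] path_props adj_sym
  by (auto simp: successively_append_iff)

lemma not_adj_consecutive:
  assumes "Suc i < length p" "x \<rightarrow> p ! i"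
  shows "\<not> x \<rightarrow> p ! Suc i"
proof
  assume *: "x \<rightarrow> p ! Suc i"
  obtain as bs where p: "p = as @ bs" and "as \<noteq> []" "bs \<noteq> []" "last as = p ! i" "hd bs = p ! Suc i"
    "successively (dominates G) as" "successively (dominates G) bs"
    using split_path assms(1) by blast
  \<comment> \<open>Here \<open>x\<close> is inserted between the two consecutive vertices.\<close>
  then have "successively (dominates G) (as @ x # bs)"
    using * assms adj_sym by (simp add: successively_append_iff successively_Cons)
  then show False
    using not_successively_permuted_insert[of "as @ x # bs"] p by simp
qed

lemma not_adj_succ_hd:
  assumes "Suc i < length p" "x \<rightarrow> p ! i"
  shows "\<not> hd p \<rightarrow> p ! Suc i"
proof
  assume *: "hd p \<rightarrow> p ! Suc i"
  obtain as bs where p: "p = as @ bs" and "as \<noteq> []" "bs \<noteq> []" "last as = p ! i" "hd bs = p ! Suc i"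
    "successively (dominates G) as" "successively (dominates G) bs"
    using split_path assms(1) by blast
  moreover from this have "hd as = hd p"
    by simp
  \<comment> \<open>From \<open>x\<close> go to \<open>p ! i\<close>, back to the start of
    \<open>p\<close>, then jump to \<open>p ! Suc i\<close> and continue.\<close>
  ultimately have "successively (dominates G) (x # rev as @ bs)"
    using * assms
    by (simp add: successively_append_iff successively_Cons successively_rev_adj last_rev hd_rev
      del: successively_rev)
  then show False
    using not_successively_permuted_insert[of "x # rev as @ bs"] p by simp
qed

lemma not_adj_succ_succ_less:
  assumes "i < j" "Suc j < length p" "x \<rightarrow> p ! i" "x \<rightarrow> p ! j"
  shows "\<not> p ! Suc i \<rightarrow> p ! Suc j"
proof
  assume *: "p ! Suc i \<rightarrow> p ! Suc j"
  \<comment> \<open>The path is cut after positions \<open>i\<close> and \<open>j\<close>.\<close>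
  define as ms bs
    where "as = take (Suc i) p" and "ms = drop (Suc i) (take (Suc j) p)" and "bs = drop (Suc j) p"
  have p: "p = as @ ms @ bs"
    using assms append_take_drop_id[of "Suc i" "take (Suc j) p"]
    by (simp add: as_def ms_def bs_def flip: append_assoc)
  have ne: "as \<noteq> []" "ms \<noteq> []" "bs \<noteq> []"
    using assms by (auto simp: as_def ms_def bs_def)
  have ends: "last as = p ! i" "last ms = p ! j"
    using assms by (auto simp: as_def ms_def take_Suc_conv_app_nth)
  have hds: "hd ms = p ! Suc i" "hd bs = p ! Suc j"
    using assms by (auto simp: ms_def bs_def hd_drop_conv_nth)
  have "successively (dominates G) as" "successively (dominates G) ms" "successively (dominates G) bs"
    using path_props(4) by (auto simp: p successively_append_iff)
  \<comment> \<open>Follow \<open>p\<close> to \<open>p ! i\<close>, pass through \<open>x\<close>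
    to \<open>p ! j\<close>, run back to \<open>p ! Suc i\<close>, then jump to
    \<open>p ! Suc j\<close>.\<close>
  then have "successively (dominates G) (as @ x # rev ms @ bs)"
    using * assms ne ends hds adj_sym
    by (auto simp: successively_append_iff successively_Cons successively_rev_adj last_rev hd_rev
      del: successively_rev)
  then show False
    using not_successively_permuted_insert[of "as @ x # rev ms @ bs"] p by simp
qed

lemma not_adj_succ_succ:
  assumes "Suc i < length p" "Suc j < length p" "x \<rightarrow> p ! i" "x \<rightarrow> p ! j"
  shows "\<not> p ! Suc i \<rightarrow> p ! Suc j"
  using assms not_adj_succ_succ_less[of i j] not_adj_succ_succ_less[of j i] adj_sym adj_not_same
  by (cases i j rule: linorder_cases) auto

lemma not_common_neighbour_off_path:
  assumes "Suc i < length p" "x \<rightarrow> p ! i" "x \<rightarrow> z" "z \<notin> set p"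
  shows "\<not> p ! Suc i \<rightarrow> z"
proof
  assume *: "p ! Suc i \<rightarrow> z"
  obtain as bs where p: "p = as @ bs" and split: "as \<noteq> []" "bs \<noteq> []" "last as = p ! i" "hd bs = p ! Suc i"
    "successively (dominates G) as" "successively (dominates G) bs"
    using split_path assms(1) by blast
  have "z \<noteq> x" "z \<in> verts G"
    using assms adj_not_same adj_in_verts by blast+
  \<comment> \<open>The detour through \<open>x\<close> and \<open>z\<close> lengthens
    \<open>p\<close> by two vertices, so maximality is applied directly.\<close>
  moreover have "successively (dominates G) (as @ [x, z] @ bs)"
    using * assms split adj_sym by (simp add: successively_append_iff successively_Cons)
  ultimately have "vpath (as @ [x, z] @ bs) G"
    using path_props x assms(4) by (auto simp: vpath_iff p)
  then show False
    using longest[of "as @ [x, z] @ bs"] p by simp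
qed

section \<open>Counting neighbours\<close>

lemma degree_sum_le:
  assumes i: "Suc i < length p" and adj: "x \<rightarrow> p ! i"
  shows "out_degree G x + out_degree G (p ! Suc i) + 2 \<le> card (verts G)"
proof -
  let ?N = "neighbours x" and ?y = "p ! Suc i"
  define J where "J = {j. j < length p \<and> x \<rightarrow> p ! j}"
  \<comment> \<open>\<open>M\<close> is the neighbourhood of \<open>x\<close> with its part on
    \<open>p\<close> shifted one step forward.\<close>
  define M where "M = (?N - set p) \<union> (\<lambda>j. p ! Suc j) ` J"
  have fin: "finite ?N" "finite (neighbours ?y)" "finite J"
    using finite_subset[OF neighbours_subset finite_verts] by (auto simp: J_def)
  \<comment> \<open>The last vertex of \<open>p\<close> is not a neighbour of \<open>x\<close>, so
    every shift stays on the path.\<close>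
  have J: "Suc j < length p" if "j \<in> J" for j
  proof (rule ccontr)
    assume "\<not> Suc j < length p"
    then have "j = length p - 1"
      using that by (auto simp: J_def)
    then show False
      using that not_adj_last path_props(1) by (auto simp: J_def last_conv_nth)
  qed
  have "?N \<inter> set p = (!) p ` J"
    by (auto simp: neighbours_def J_def in_set_conv_nth)
  moreover have "inj_on ((!) p) J"
    using path_props(3) by (auto simp: inj_on_def J_def nth_eq_iff_index_eq)
  moreover have "inj_on (\<lambda>j. p ! Suc j) J"
    using path_props(3) J by (auto simp: inj_on_def nth_eq_iff_index_eq)
  ultimately have "card ((\<lambda>j. p ! Suc j) ` J) = card (?N \<inter> set p)"
    by (simp add: card_image)
  moreover have "card M = card (?N - set p) + card ((\<lambda>j. p ! Suc j) ` J)"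
    unfolding M_def using fin J by (intro card_Un_disjoint) auto
  moreover have "card ?N = card (?N - set p) + card (?N \<inter> set p)"
    using fin by (subst card_Un_disjoint[symmetric]) (auto intro!: arg_cong[where f = card])
  ultimately have card_M: "card M = card ?N"
    by simp
  \<comment> \<open>The first fact handles the neighbours off \<open>p\<close>, the second the
    shifted ones, including \<open>p ! Suc i\<close> itself.\<close>
  have disj: "M \<inter> neighbours ?y = {}"
    using not_common_neighbour_off_path[OF i adj] not_adj_succ_succ[OF i _ adj] J
    by (auto simp: M_def neighbours_def J_def)
  have hd: "hd p \<in> set p" "hd p = p ! 0"
    using path_props(1) by (auto simp: hd_conv_nth)
  have "hd p \<noteq> p ! Suc j" if "j \<in> J" for j
    using J[OF that] path_props(3) hd nth_eq_iff_index_eq[of p 0 "Suc j"] path_props(1) by auto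
  then have hd_M: "hd p \<notin> M"
    using hd by (auto simp: M_def)
  have x_M: "x \<notin> M"
    using J x(2) adj_not_same nth_mem by (fastforce simp: M_def neighbours_def)
  have "hd p \<notin> neighbours ?y" "x \<notin> neighbours ?y"
    using not_adj_succ_hd[OF i adj] not_adj_consecutive[OF i adj] adj_sym
    by (auto simp: neighbours_def)
  moreover have "M \<subseteq> verts G"
    using neighbours_subset J path_props(2) by (auto simp: M_def)
  \<comment> \<open>The two vertices left out account for the 2 in the bound.\<close>
  ultimately have "M \<union> neighbours ?y \<subseteq> verts G - {x, hd p}"
    using neighbours_subset x_M hd_M by auto
  then have "card (M \<union> neighbours ?y) \<le> card (verts G - {x, hd p})"
    by (intro card_mono) auto
  moreover have "x \<noteq> hd p"
    using x hd by auto
  then have "card {x, hd p} = 2"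
    by simp
  moreover have xh: "{x, hd p} \<subseteq> verts G"
    using x hd path_props(2) by auto
  ultimately show ?thesis
    using fin disj card_M card_mono[OF finite_verts xh]
    by (simp add: out_degree_eq_card_neighbours card_Un_disjoint card_Diff_subset M_def)
qed

end

end

theorem theorem5:
  fixes G :: "('a, 'b) pre_digraph"
  assumes "graph G"
    and "connected G"
    and "o_minus_one_heavy (with_proj (path_graph 3)) G"
  shows "traceable G"
proof -
  interpret graph G by fact
  have "verts G \<noteq> {}"
    using assms(2) by (auto simp: connected_def strongly_connected_def)
  then obtain p where p: "vpath p G" and longest: "\<And>q. vpath q G \<Longrightarrow> length q \<le> length p"
    using exists_longest_vpath by blast
  have "set p = verts G"
  proof (rule ccontr)
    assume "set p \<noteq> verts G"
    then obtain w x where "w \<in> set p" and x: "x \<in> verts G" "x \<notin> set p" and "w \<rightarrow>\<^bsub>G\<^esub> x"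
      using connected_exits_subset[OF assms(2), of "set p"] p by (auto simp: vpath_iff)
    then obtain i where i: "i < length p" "x \<rightarrow>\<^bsub>G\<^esub> p ! i"
      using adj_sym by (auto simp: in_set_conv_nth)
    have Suc_i: "Suc i < length p"
    proof (rule ccontr)
      assume "\<not> Suc i < length p"
      then have "p ! i = last p"
        using i last_conv_nth[of p] by (cases p) (auto simp: not_less_eq less_Suc_eq)
      then show False
        using not_adj_last[OF p longest x] i by simp
    qed
    have "p ! i \<rightarrow>\<^bsub>G\<^esub> p ! Suc i"
      using p Suc_i by (simp add: vpath_iff successively_conv_nth)
    moreover have "x \<noteq> p ! Suc i"
      using x Suc_i by auto
    ultimately have "card (verts G) - 1 \<le> out_degree G x + out_degree G (p ! Suc i)"
      using o_minus_one_heavy_path_graph_3D[OF assms(3) i(2)]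
        not_adj_consecutive[OF p longest x Suc_i i(2)] by blast
    \<comment> \<open>The bound in \<open>degree_sum_le\<close> forces at least two vertices, so the
      truncated subtraction is genuine.\<close>
    then show False
      using degree_sum_le[OF p longest x Suc_i i(2)] by simp
  qed
  with p show ?thesis
    by (auto simp: traceable_def)
qed

end
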